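(* Let $(W,S)$ be a Coxeter system, $\mathbb{F}$ a field, and $\mathbf{q}=(q_s\in\mathbb{F}: s\in S)$. The Hecke algebra $\mathcal{H}(\mathbf{q})$ of $(W,S)$ with independent parameters $\mathbf{q}$ is collapse-free and commutative if and only if $(W,S)$ is simply laced and, for every pair $s,t\in S$ with $m_{st}=3$, exactly one of $q_s$ and $q_t$ is $0$.
   Context: A Coxeter system $(W,S)$ has $S$ finite and $W=\langle S: s^2=1,\ (sts\cdots)_{m_{st}}=(tst\cdots)_{m_{st}}\ \forall s\ne t\in S\rangle$, where $m_{st}=m_{ts}\in\{2,3,\ldots\}\cup\{\infty\}$ and $(aba\cdots)_m$ denotes the alternating product of $m$ factors starting with $a$; no relation is imposed between $s$ and $t$ if $m_{st}=\infty$ (and $\infty$ is not odd). The system is simply laced if $m_{st}\in\{2,3\}$ for all $s\ne t$ in $S$. The Hecke algebra $\mathcal{H}(\mathbf{q})=\mathcal{H}_S(\mathbf{q})$ of $(W,S)$ with independent parameters $\mathbf{q}=(q_s\in\mathbb{F}:s\in S)$ is the unital associative $\mathbb{F}$-algebra generated by $\{T_s:s\in S\}$ subject to the quadratic relations $(T_s-1)(T_s+q_s)=0$ for all $s\in S$ and the braid relations $(T_sT_tT_s\cdots)_{m_{st}}=(T_tT_sT_t\cdots)_{m_{st}}$ for all $s\neq t$ in $S$ (none if $m_{st}=\infty$). $\mathcal{H}(\mathbf{q})$ is called collapse-free if, whenever $m_{st}$ is odd and $q_s\neq q_t$, at least one of $q_s$ and $q_t$ is $0$. *)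

theory Defs
  imports
    "HOL-Algebra.QuotRing"
    "HOL-Algebra.Module"
    "HOL-Algebra.Generated_Groups"
    "HOL-Library.Poly_Mapping"
    "HOL-Library.Extended_Nat"
begin

section \<open>Coxeter systems\<close>

fun alternating :: "'a \<Rightarrow> 'a \<Rightarrow> nat \<Rightarrow> 'a list" where
  "alternating a b 0 = []"
| "alternating a b (Suc n) = a # alternating b a n"

text \<open>
  Group words over a set \<open>S\<close> are lists of pairs \<open>(s, e)\<close> with \<open>s \<in> S\<close>, where \<open>(s, True)\<close> stands
  for \<open>s\<close> and \<open>(s, False)\<close> for its formal inverse.
\<close>

primrec eval_word :: "('a, 'b) monoid_scheme \<Rightarrow> ('a \<times> bool) list \<Rightarrow> 'a" where
  "eval_word G [] = \<one>\<^bsub>G\<^esub>"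
| "eval_word G (x # w) = (if snd x then fst x else inv\<^bsub>G\<^esub> (fst x)) \<otimes>\<^bsub>G\<^esub> eval_word G w"

text \<open>
  Equality of two group words in the abstract group with generators \<open>S\<close> and defining relations
  \<open>u = v\<close> for \<open>(u, v) \<in> R\<close>.
\<close>

inductive pres_eq ::
    "'a set \<Rightarrow> (('a \<times> bool) list \<times> ('a \<times> bool) list) set \<Rightarrow>
      ('a \<times> bool) list \<Rightarrow> ('a \<times> bool) list \<Rightarrow> bool"
  for S R where
  refl: "pres_eq S R w w"
| sym: "pres_eq S R v w \<Longrightarrow> pres_eq S R w v"
| trans: "pres_eq S R u v \<Longrightarrow> pres_eq S R v w \<Longrightarrow> pres_eq S R u w"
| cancel: "s \<in> S \<Longrightarrow> pres_eq S R (x @ [(s, e), (s, \<not> e)] @ y) (x @ y)"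
| relation: "(u, v) \<in> R \<Longrightarrow> pres_eq S R (x @ u @ y) (x @ v @ y)"

text \<open>\<open>G = \<langle>S : u = v for all (u, v) \<in> R\<rangle>\<close>\<close>

definition has_presentation ::
    "('a, 'b) monoid_scheme \<Rightarrow> 'a set \<Rightarrow> (('a \<times> bool) list \<times> ('a \<times> bool) list) set \<Rightarrow> bool" where
  "has_presentation G S R \<longleftrightarrow>
     group G \<and> S \<subseteq> carrier G \<and> generate G S = carrier G \<and>
     (\<forall>v w. set v \<subseteq> S \<times> UNIV \<longrightarrow> set w \<subseteq> S \<times> UNIV \<longrightarrow>
        (eval_word G v = eval_word G w \<longleftrightarrow> pres_eq S R v w))"

definition coxeter_relations ::
    "'a set \<Rightarrow> ('a \<Rightarrow> 'a \<Rightarrow> enat) \<Rightarrow> (('a \<times> bool) list \<times> ('a \<times> bool) list) set" where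
  "coxeter_relations S m =
     {([(s, True), (s, True)], []) | s. s \<in> S} \<union>
     {(map (\<lambda>x. (x, True)) (alternating s t k), map (\<lambda>x. (x, True)) (alternating t s k)) | s t k.
        s \<in> S \<and> t \<in> S \<and> s \<noteq> t \<and> m s t = enat k}"

text \<open>The values \<open>m s s\<close>, and those of \<open>m\<close> outside \<open>S\<close>, are irrelevant here and below.\<close>

definition coxeter_system ::
    "('a, 'b) monoid_scheme \<Rightarrow> 'a set \<Rightarrow> ('a \<Rightarrow> 'a \<Rightarrow> enat) \<Rightarrow> bool" where
  "coxeter_system W S m \<longleftrightarrow>
     finite S \<and>
     (\<forall>s\<in>S. \<forall>t\<in>S. s \<noteq> t \<longrightarrow> 2 \<le> m s t \<and> m s t = m t s) \<and>
     has_presentation W S (coxeter_relations S m)"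

definition simply_laced :: "'a set \<Rightarrow> ('a \<Rightarrow> 'a \<Rightarrow> enat) \<Rightarrow> bool" where
  "simply_laced S m \<longleftrightarrow> (\<forall>s\<in>S. \<forall>t\<in>S. s \<noteq> t \<longrightarrow> m s t = 2 \<or> m s t = 3)"


section \<open>The free algebra on a set of generators\<close>

datatype 'a free_monoid = Word (letters: "'a list")

instantiation free_monoid :: (type) monoid_add
begin

definition "0 = Word []"
definition "v + w = Word (letters v @ letters w)"

instance
  by standard (simp_all add: zero_free_monoid_def plus_free_monoid_def)

end

text \<open>
  With the additive notation for concatenation, \<open>'a free_monoid \<Rightarrow>\<^sub>0 'f\<close> is the monoid algebra of
  the free monoid on the type \<open>'a\<close>. The free algebra on \<open>S\<close> is the subalgebra of those elements
  that only involve words over \<open>S\<close>.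
\<close>

definition scalar :: "'f \<Rightarrow> 'a free_monoid \<Rightarrow>\<^sub>0 'f::field" where
  "scalar c = Poly_Mapping.single 0 c"

definition gen :: "'a \<Rightarrow> 'a free_monoid \<Rightarrow>\<^sub>0 'f::field" where
  "gen s = Poly_Mapping.single (Word [s]) 1"

definition free_algebra :: "'a set \<Rightarrow> ('f::field, 'a free_monoid \<Rightarrow>\<^sub>0 'f) module" where
  "free_algebra S =
     \<lparr>carrier = {p. \<forall>w\<in>Poly_Mapping.keys p. set (letters w) \<subseteq> S},
      mult = (*), one = 1, zero = 0, add = (+), smult = (\<lambda>c p. scalar c * p)\<rparr>"

text \<open>The ring \<open>A Quot I\<close> together with the induced scalar multiplication.\<close>

definition quotient_algebra :: "('f, 'b) module \<Rightarrow> 'b set \<Rightarrow> ('f, 'b set) module" where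
  "quotient_algebra A I =
     \<lparr>carrier = carrier (A Quot I), mult = mult (A Quot I), one = one (A Quot I),
      zero = zero (A Quot I), add = add (A Quot I),
      smult = (\<lambda>c X. \<Union>x\<in>X. I +>\<^bsub>A\<^esub> (c \<odot>\<^bsub>A\<^esub> x))\<rparr>"


section \<open>Hecke algebras with independent parameters\<close>

definition hecke_relators ::
    "'a set \<Rightarrow> ('a \<Rightarrow> 'a \<Rightarrow> enat) \<Rightarrow> ('a \<Rightarrow> 'f::field) \<Rightarrow> ('a free_monoid \<Rightarrow>\<^sub>0 'f) set" where
  "hecke_relators S m q =
     {(gen s - 1) * (gen s + scalar (q s)) | s. s \<in> S} \<union>
     {prod_list (map gen (alternating s t k)) - prod_list (map gen (alternating t s k)) | s t k.
        s \<in> S \<and> t \<in> S \<and> s \<noteq> t \<and> m s t = enat k}"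

definition hecke_algebra ::
    "'a set \<Rightarrow> ('a \<Rightarrow> 'a \<Rightarrow> enat) \<Rightarrow> ('a \<Rightarrow> 'f::field) \<Rightarrow> ('f, ('a free_monoid \<Rightarrow>\<^sub>0 'f) set) module" where
  "hecke_algebra S m q =
     quotient_algebra (free_algebra S) (genideal (free_algebra S) (hecke_relators S m q))"

definition collapse_free ::
    "'a set \<Rightarrow> ('a \<Rightarrow> 'a \<Rightarrow> enat) \<Rightarrow> ('a \<Rightarrow> 'f::field) \<Rightarrow> bool" where
  "collapse_free S m q \<longleftrightarrow>
     (\<forall>s\<in>S. \<forall>t\<in>S. \<forall>k. s \<noteq> t \<longrightarrow> m s t = enat k \<longrightarrow> odd k \<longrightarrow> q s \<noteq> q t \<longrightarrow> q s = 0 \<or> q t = 0)"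


section \<open>The Hecke algebra is a ring\<close>

lemma free_algebra_simps [simp]:
  "mult (free_algebra S) = (*)" "one (free_algebra S) = 1"
  "zero (free_algebra S) = 0" "add (free_algebra S) = (+)"
  by (simp_all add: free_algebra_def)

lemma carrier_free_algebra:
  "p \<in> carrier (free_algebra S) \<longleftrightarrow> (\<forall>w\<in>Poly_Mapping.keys p. set (letters w) \<subseteq> S)"
  by (simp add: free_algebra_def)

lemma gen_in_free_algebra: "s \<in> S \<Longrightarrow> gen s \<in> carrier (free_algebra S)"
  by (simp add: carrier_free_algebra gen_def)

lemma scalar_in_free_algebra: "scalar c \<in> carrier (free_algebra S)"
  by (simp add: carrier_free_algebra scalar_def zero_free_monoid_def)

lemma ring_free_algebra: "ring (free_algebra S :: ('f::field, 'a free_monoid \<Rightarrow>\<^sub>0 'f) module)"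
proof (rule ringI)
  show "abelian_group (free_algebra S :: ('f, 'a free_monoid \<Rightarrow>\<^sub>0 'f) module)"
  proof (rule abelian_groupI)
    fix p :: "'a free_monoid \<Rightarrow>\<^sub>0 'f"
    assume "p \<in> carrier (free_algebra S)"
    then have "- p \<in> carrier (free_algebra S)"
      by (simp add: carrier_free_algebra)
    then show "\<exists>r\<in>carrier (free_algebra S). r \<oplus>\<^bsub>free_algebra S\<^esub> p = \<zero>\<^bsub>free_algebra S\<^esub>"
      by (intro bexI[of _ "- p"]) simp_all
  next
    fix p r :: "'a free_monoid \<Rightarrow>\<^sub>0 'f"
    assume "p \<in> carrier (free_algebra S)" "r \<in> carrier (free_algebra S)"
    then show "p \<oplus>\<^bsub>free_algebra S\<^esub> r \<in> carrier (free_algebra S)"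
      using Poly_Mapping.keys_add[of p r] by (fastforce simp: carrier_free_algebra)
  qed (simp_all add: carrier_free_algebra ac_simps)
  show "monoid (free_algebra S :: ('f, 'a free_monoid \<Rightarrow>\<^sub>0 'f) module)"
  proof (rule monoidI)
    fix p r :: "'a free_monoid \<Rightarrow>\<^sub>0 'f"
    assume "p \<in> carrier (free_algebra S)" "r \<in> carrier (free_algebra S)"
    then show "p \<otimes>\<^bsub>free_algebra S\<^esub> r \<in> carrier (free_algebra S)"
      using keys_mult[of p r] by (fastforce simp: carrier_free_algebra plus_free_monoid_def)
  qed (use scalar_in_free_algebra[of 1 S] in \<open>simp_all add: scalar_def mult.assoc\<close>)
qed (simp_all add: algebra_simps)

lemma hecke_relators_subset: "hecke_relators S m q \<subseteq> carrier (free_algebra S)"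
proof -
  let ?C = "carrier (free_algebra S) :: ('a free_monoid \<Rightarrow>\<^sub>0 'b) set"
  have one: "1 \<in> ?C"
    using monoid.one_closed[OF ring.is_monoid[OF ring_free_algebra]] by simp
  have mult: "p * r \<in> ?C" if "p \<in> ?C" "r \<in> ?C" for p r
    using monoid.m_closed[OF ring.is_monoid[OF ring_free_algebra] that] by simp
  have add: "p + r \<in> ?C" if "p \<in> ?C" "r \<in> ?C" for p r
    using that Poly_Mapping.keys_add[of p r] by (fastforce simp: carrier_free_algebra)
  have minus: "p - r \<in> ?C" if "p \<in> ?C" "r \<in> ?C" for p r
    using that keys_diff[of p r] by (fastforce simp: carrier_free_algebra)
  have prod: "prod_list (map gen w) \<in> ?C" if "set w \<subseteq> S" for w
    using that by (induction w) (auto intro: one mult gen_in_free_algebra)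
  have alt: "set (alternating s t k) \<subseteq> {s, t}" for s t :: 'a and k
    by (induction s t k rule: alternating.induct) auto
  have braid: "prod_list (map gen (alternating s t k)) \<in> ?C" if "s \<in> S" "t \<in> S" for s t k
    using that alt[of s t k] by (intro prod) auto
  show ?thesis
  proof
    fix p
    assume "p \<in> hecke_relators S m q"
    then consider s where "p = (gen s - 1) * (gen s + scalar (q s))" "s \<in> S"
      | s t k where "p = prod_list (map gen (alternating s t k)) - prod_list (map gen (alternating t s k))"
          "s \<in> S" "t \<in> S"
      unfolding hecke_relators_def by blast
    then show "p \<in> ?C"
      by cases (simp_all add: one mult add minus gen_in_free_algebra scalar_in_free_algebra braid)
  qed
qed

lemma ring_hecke_algebra: "ring (hecke_algebra S m q)"
proof -
  define A where "A = (free_algebra S :: ('b, 'a free_monoid \<Rightarrow>\<^sub>0 'b) module)"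
  define I where "I = genideal A (hecke_relators S m q)"
  have "ring A"
    unfolding A_def by (rule ring_free_algebra)
  then have "ideal I A"
    unfolding I_def A_def by (intro ring.genideal_ideal hecke_relators_subset)
  then have Q: "ring (A Quot I)"
    by (rule ideal.quotient_is_ring)
  interpret Q: ring "A Quot I"
    by (rule Q)
  have "ring (quotient_algebra A I)"
  proof (rule ringI)
    show "abelian_group (quotient_algebra A I)"
    proof (rule abelian_groupI)
      fix X
      assume "X \<in> carrier (quotient_algebra A I)"
      then show "\<exists>Y\<in>carrier (quotient_algebra A I).
          Y \<oplus>\<^bsub>quotient_algebra A I\<^esub> X = \<zero>\<^bsub>quotient_algebra A I\<^esub>"
        by (intro bexI[of _ "\<ominus>\<^bsub>A Quot I\<^esub> X"]) (simp_all add: quotient_algebra_def Q.l_neg)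
    qed (simp_all add: quotient_algebra_def Q.a_ac)
    show "monoid (quotient_algebra A I)"
      by (rule monoidI) (simp_all add: quotient_algebra_def Q.m_assoc)
  qed (simp_all add: quotient_algebra_def Q.l_distr Q.r_distr)
  then show ?thesis
    by (simp add: hecke_algebra_def A_def I_def)
qed

end

theory Submission
  imports
    Defs
    "HOL-Algebra.Algebraic_Closure_Type"
    "HOL-Library.Function_Algebras"
    "HOL-Library.Product_Plus"
begin

text \<open>
  If \<open>T\<^sub>s\<close> is idempotent and \<open>q\<^sub>t \<noteq> 0\<close>, then a braid relation of length 3 makes \<open>T\<^sub>s T\<^sub>t T\<^sub>s\<close> absorb \<open>T\<^sub>s\<close>,
  and comparing with \<open>T\<^sub>t\<^sup>2 = (1 - q\<^sub>t) T\<^sub>t + q\<^sub>t\<close> gives \<open>T\<^sub>s T\<^sub>t = T\<^sub>t T\<^sub>s\<close>. This is the direction from right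
  to left.

  Conversely, two kinds of representations detect noncommutativity. Generators with parameter 0 may
  always be sent to 0, because both sides of a braid relation contain both letters. The remaining
  generators then act on functions \<open>z\<close> by a deformed reflection representation
  \<open>z \<mapsto> z - z\<^sub>s A\<^sub>s\<close> with \<open>A\<^sub>s\<^sub>s = 1 + q\<^sub>s\<close>. The braid relation for \<open>s, t\<close> holds if \<open>A\<^sub>s\<^sub>t A\<^sub>t\<^sub>s\<close> is
  a root of a Chebyshev-like polynomial, and such a root exists in the algebraic closure. (For odd
  length this needs \<open>q\<^sub>s = q\<^sub>t\<close>, which is collapse-freeness.) Hence \<open>m\<^sub>s\<^sub>t = 2\<close> whenever
  \<open>q\<^sub>s, q\<^sub>t \<noteq> 0\<close>. If \<open>q\<^sub>s = 0\<close>, there is a two-dimensional representation in which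
  \<open>T\<^sub>s T\<^sub>t T\<^sub>s = 0 \<noteq> T\<^sub>s T\<^sub>t\<close>, while every other generator acts as 0 or 1 according to whether
  its parameter is 0 or not. The previous case handles the relations between \<open>T\<^sub>t\<close> and the
  generators acting as 1; the representation satisfies the braid relation of \<open>s, t\<close> if it has
  length at least 4, and also that of length 3 if \<open>q\<^sub>t = 0\<close>.
\<close>

section \<open>Commutation modulo the Hecke relations\<close>

lemma poly_mapping_eq_sum_single:
  "p = (\<Sum>w\<in>Poly_Mapping.keys p. Poly_Mapping.single w (Poly_Mapping.lookup p w))"
proof (rule poly_mapping_eqI)
  fix v
  show "Poly_Mapping.lookup p v = Poly_Mapping.lookup
      (\<Sum>w\<in>Poly_Mapping.keys p. Poly_Mapping.single w (Poly_Mapping.lookup p w)) v"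
    by (simp add: lookup_sum lookup_single when_def sum.delta in_keys_iff)
qed

lemma scalar_mult_commute: "scalar c * p = p * (scalar c :: 'a free_monoid \<Rightarrow>\<^sub>0 'f::field)"
proof -
  have single: "scalar c * Poly_Mapping.single w d =
      Poly_Mapping.single w d * (scalar c :: 'a free_monoid \<Rightarrow>\<^sub>0 'f)" for w d
    by (simp add: scalar_def mult_single mult.commute)
  have "scalar c * (\<Sum>w\<in>A. Poly_Mapping.single w (f w)) =
      (\<Sum>w\<in>A. Poly_Mapping.single w (f w)) * (scalar c :: 'a free_monoid \<Rightarrow>\<^sub>0 'f)" for A f
    by (induction A rule: infinite_finite_induct) (simp_all add: distrib_left distrib_right single)
  then show ?thesis
    using poly_mapping_eq_sum_single[of p] by metis
qed

lemma scalar_mult_left_commute: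
  "p * (scalar c * r) = (scalar c :: 'a free_monoid \<Rightarrow>\<^sub>0 'f::field) * (p * r)"
  using scalar_mult_commute[of c p] by (simp flip: mult.assoc)

lemma scalar_mult_scalar: "scalar c * scalar d = scalar (c * d)"
  by (simp add: scalar_def mult_single)

lemma scalar_one: "scalar 1 = 1"
  by (simp add: scalar_def)

lemma single_eq_scalar_mult_prod_gen:
  "Poly_Mapping.single (Word w) c = scalar c * prod_list (map gen w)"
proof -
  have "prod_list (map gen w) = Poly_Mapping.single (Word w) (1::'b)"
    by (induction w) (simp_all add: gen_def mult_single plus_free_monoid_def flip: zero_free_monoid_def)
  then show ?thesis
    by (simp add: scalar_def mult_single)
qed

lemma free_algebra_induct [consumes 1, case_names scalar gen add mult]:
  assumes "p \<in> carrier (free_algebra S)"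
    and scalar: "\<And>c. P (scalar c)"
    and gen: "\<And>s. s \<in> S \<Longrightarrow> P (gen s)"
    and add: "\<And>p r. P p \<Longrightarrow> P r \<Longrightarrow> P (p + r)"
    and mult: "\<And>p r. P p \<Longrightarrow> P r \<Longrightarrow> P (p * r)"
  shows "P p"
proof -
  have word: "P (prod_list (map gen w))" if "set w \<subseteq> S" for w
    using that by (induction w) (auto intro: mult gen simp: scalar[of 1, unfolded scalar_one])
  have "P (\<Sum>w\<in>A. Poly_Mapping.single w (f w))" if "finite A" "\<forall>w\<in>A. set (letters w) \<subseteq> S" for A f
    using that
  proof (induction A rule: finite_induct)
    case empty
    show ?case
      using scalar[of 0] by (simp add: scalar_def)
  next
    case (insert w A)
    have "P (Poly_Mapping.single w (f w))"
      using insert.prems single_eq_scalar_mult_prod_gen[of "letters w" "f w"]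
      by (auto intro!: mult scalar word)
    then show ?case
      using insert by (auto intro: add)
  qed
  then show ?thesis
    using assms(1) poly_mapping_eq_sum_single[of p] by (metis carrier_free_algebra finite_keys)
qed

lemma a_minus_free_algebra:
  assumes "p \<in> carrier (free_algebra S)" "r \<in> carrier (free_algebra S)"
  shows "p \<ominus>\<^bsub>free_algebra S\<^esub> r = p - r"
proof -
  interpret ring "free_algebra S :: ('b, 'a free_monoid \<Rightarrow>\<^sub>0 'b) module"
    by (rule ring_free_algebra)
  have "- r \<in> carrier (free_algebra S)"
    using assms by (simp add: carrier_free_algebra)
  then have "\<ominus>\<^bsub>free_algebra S\<^esub> r = - r"
    using assms by (intro minus_equality) simp_all
  then show ?thesis
    by (simp add: a_minus_def)
qed

text \<open>The cosets of \<open>p * r\<close> and \<open>r * p\<close> agree exactly when the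
  difference lies in \<open>I\<close>. This turns commutativity into ideal membership, so cosets can
  be avoided from here on.\<close>

lemma cring_quotient_algebra_iff:
  assumes "ideal I (free_algebra S)" and "ring (quotient_algebra (free_algebra S) I)"
  shows "cring (quotient_algebra (free_algebra S) I) \<longleftrightarrow>
    (\<forall>p\<in>carrier (free_algebra S). \<forall>r\<in>carrier (free_algebra S). p * r - r * p \<in> I)"
proof -
  let ?A = "free_algebra S :: ('b, 'a free_monoid \<Rightarrow>\<^sub>0 'b) module"
  let ?Q = "quotient_algebra ?A I"
  interpret ideal I ?A
    by (rule assms(1))
  have car: "carrier ?Q = (\<lambda>p. I +>\<^bsub>?A\<^esub> p) ` carrier ?A"
    by (auto simp: quotient_algebra_def FactRing_def A_RCOSETS_def' )
  have mult: "(I +>\<^bsub>?A\<^esub> p) \<otimes>\<^bsub>?Q\<^esub> (I +>\<^bsub>?A\<^esub> r) = I +>\<^bsub>?A\<^esub> (p * r)"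
    if "p \<in> carrier ?A" "r \<in> carrier ?A" for p r
    using rcoset_mult_add[OF that] by (simp add: quotient_algebra_def FactRing_def)
  have eq: "I +>\<^bsub>?A\<^esub> (p * r) = I +>\<^bsub>?A\<^esub> (r * p) \<longleftrightarrow> p * r - r * p \<in> I"
    if "p \<in> carrier ?A" "r \<in> carrier ?A" for p r
  proof -
    have "p * r \<in> carrier ?A" "r * p \<in> carrier ?A"
      using m_closed[of p r] m_closed[of r p] that by simp_all
    then show ?thesis
      using quotient_eq_iff_same_a_r_cos[OF assms(1), of "p * r" "r * p"] a_minus_free_algebra by metis
  qed
  have "cring ?Q \<longleftrightarrow> (\<forall>x\<in>carrier ?Q. \<forall>y\<in>carrier ?Q. x \<otimes>\<^bsub>?Q\<^esub> y = y \<otimes>\<^bsub>?Q\<^esub> x)"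
    using assms(2) by (auto simp: cring_def comm_monoid_def comm_monoid_axioms_def ring_def)
  also have "\<dots> \<longleftrightarrow> (\<forall>p\<in>carrier ?A. \<forall>r\<in>carrier ?A. p * r - r * p \<in> I)"
    by (simp add: car mult eq)
  finally show ?thesis .
qed

section \<open>Commutators modulo the Hecke ideal\<close>

definition hecke_ideal ::
    "'a set \<Rightarrow> ('a \<Rightarrow> 'a \<Rightarrow> enat) \<Rightarrow> ('a \<Rightarrow> 'f::field) \<Rightarrow> ('a free_monoid \<Rightarrow>\<^sub>0 'f) set" where
  "hecke_ideal S m q = genideal (free_algebra S) (hecke_relators S m q)"

lemma ideal_hecke_ideal: "ideal (hecke_ideal S m q) (free_algebra S)"
  unfolding hecke_ideal_def by (intro ring.genideal_ideal ring_free_algebra hecke_relators_subset)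

context
  fixes S :: "'a set" and m :: "'a \<Rightarrow> 'a \<Rightarrow> enat" and q :: "'a \<Rightarrow> 'f::field"
begin

interpretation ideal "hecke_ideal S m q" "free_algebra S"
  by (rule ideal_hecke_ideal)

lemma hecke_ideal_add: "p \<in> hecke_ideal S m q \<Longrightarrow> r \<in> hecke_ideal S m q \<Longrightarrow> p + r \<in> hecke_ideal S m q"
  using additive_subgroup.a_closed[OF additive_subgroup_axioms, of p r] by simp

lemma hecke_ideal_mult_left: "p \<in> hecke_ideal S m q \<Longrightarrow> r \<in> carrier (free_algebra S) \<Longrightarrow> r * p \<in> hecke_ideal S m q"
  using I_l_closed[of p r] by simp

lemma hecke_ideal_mult_right: "p \<in> hecke_ideal S m q \<Longrightarrow> r \<in> carrier (free_algebra S) \<Longrightarrow> p * r \<in> hecke_ideal S m q"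
  using I_r_closed[of p r] by simp

lemma hecke_ideal_uminus: "p \<in> hecke_ideal S m q \<Longrightarrow> - p \<in> hecke_ideal S m q"
  using hecke_ideal_mult_left[of p "scalar (-1)"] scalar_in_free_algebra[of "-1" S]
  by (simp add: scalar_def single_uminus)

lemma hecke_ideal_diff: "p \<in> hecke_ideal S m q \<Longrightarrow> r \<in> hecke_ideal S m q \<Longrightarrow> p - r \<in> hecke_ideal S m q"
  using hecke_ideal_add[of p "- r"] hecke_ideal_uminus[of r] by simp

lemma hecke_ideal_relators: "hecke_relators S m q \<subseteq> hecke_ideal S m q"
  unfolding hecke_ideal_def by (intro ring.genideal_self ring_free_algebra hecke_relators_subset)

lemma hecke_ideal_quadratic: "s \<in> S \<Longrightarrow> (gen s - 1) * (gen s + scalar (q s)) \<in> hecke_ideal S m q"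
  using hecke_ideal_relators by (auto simp: hecke_relators_def)

lemma hecke_ideal_braid:
  "s \<in> S \<Longrightarrow> t \<in> S \<Longrightarrow> s \<noteq> t \<Longrightarrow> m s t = enat k \<Longrightarrow>
    prod_list (map gen (alternating s t k)) - prod_list (map gen (alternating t s k)) \<in> hecke_ideal S m q"
  by (rule subsetD[OF hecke_ideal_relators]) (auto simp: hecke_relators_def)

lemma cring_hecke_algebra_iff:
  "cring (hecke_algebra S m q) \<longleftrightarrow>
    (\<forall>p\<in>carrier (free_algebra S). \<forall>r\<in>carrier (free_algebra S). p * r - r * p \<in> hecke_ideal S m q)"
  using cring_quotient_algebra_iff[OF ideal_axioms] ring_hecke_algebra[of S m q]
  by (simp add: hecke_algebra_def hecke_ideal_def)

text \<open>The commutator with \<open>x\<close> is a derivation,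
  \<open>[p r, x] = p [r, x] + [p, x] r\<close>, so the elements commuting with \<open>x\<close>
  modulo the ideal form a subalgebra.\<close>

lemma commute_mem_if_gens_commute:
  assumes "x \<in> carrier (free_algebra S)" "p \<in> carrier (free_algebra S)"
    and gens: "\<And>s. s \<in> S \<Longrightarrow> gen s * x - x * gen s \<in> hecke_ideal S m q"
  shows "p * x - x * p \<in> hecke_ideal S m q"
proof -
  \<comment> \<open>The carrier is part of the claim because the ideal absorbs only factors from the
    free algebra on \<open>S\<close>.\<close>
  have "p \<in> carrier (free_algebra S) \<and> p * x - x * p \<in> hecke_ideal S m q"
    using assms(2)
  proof (induction p rule: free_algebra_induct)
    case (scalar c)
    show ?case
      using additive_subgroup.zero_closed[OF additive_subgroup_axioms]
      by (simp add: scalar_mult_commute[of c x] scalar_in_free_algebra)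
  next
    case (gen s)
    then show ?case
      by (simp add: gens gen_in_free_algebra)
  next
    case (add p r)
    moreover have "(p + r) * x - x * (p + r) = (p * x - x * p) + (r * x - x * r)"
      by (simp add: algebra_simps)
    moreover have "p + r \<in> carrier (free_algebra S)"
      using add add.m_closed[of p r] by simp
    ultimately show ?case
      using hecke_ideal_add by metis
  next
    case (mult p r)
    moreover have "(p * r) * x - x * (p * r) = p * (r * x - x * r) + (p * x - x * p) * r"
      by (simp add: algebra_simps)
    moreover have "p * r \<in> carrier (free_algebra S)"
      using mult m_closed[of p r] by simp
    ultimately show ?case
      using hecke_ideal_add hecke_ideal_mult_left hecke_ideal_mult_right by metis
  qed
  then show ?thesis ..
qed

text \<open>The centralizer argument runs twice, first against a generator and then against an
  arbitrary element.\<close>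

lemma cring_hecke_algebra_if_gens_commute:
  assumes "\<And>s t. s \<in> S \<Longrightarrow> t \<in> S \<Longrightarrow> gen s * gen t - gen t * gen s \<in> hecke_ideal S m q"
  shows "cring (hecke_algebra S m q)"
proof -
  have gen: "p * gen s - gen s * p \<in> hecke_ideal S m q" if "s \<in> S" "p \<in> carrier (free_algebra S)" for s p
    using that assms by (simp add: commute_mem_if_gens_commute gen_in_free_algebra)
  have "gen s * p - p * gen s \<in> hecke_ideal S m q" if "s \<in> S" "p \<in> carrier (free_algebra S)" for s p
    using hecke_ideal_uminus[OF gen[OF that]] by simp
  then show ?thesis
    unfolding cring_hecke_algebra_iff using commute_mem_if_gens_commute by blast
qed

lemma braid3_commute_mem_hecke_ideal:
  assumes "s \<in> S" "t \<in> S" "s \<noteq> t" "m s t = 3" and q: "q s = 0" "q t \<noteq> 0"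
  shows "gen s * gen t - gen t * gen s \<in> hecke_ideal S m q"
proof -
  define a b where "a = (gen s :: 'a free_monoid \<Rightarrow>\<^sub>0 'f)" and "b = (gen t :: 'a free_monoid \<Rightarrow>\<^sub>0 'f)"
  let ?C = "carrier (free_algebra S) :: ('a free_monoid \<Rightarrow>\<^sub>0 'f) set"
  let ?c = "scalar (q t) :: 'a free_monoid \<Rightarrow>\<^sub>0 'f"
  define Ra where "Ra = (a - 1) * a"
  define Rb where "Rb = (b - 1) * (b + ?c)"
  define R where "R = a * b * a - b * a * b"
  have C: "a \<in> ?C" "b \<in> ?C" "a * b \<in> ?C" "b * a \<in> ?C"
    using gen_in_free_algebra[of s S] gen_in_free_algebra[of t S] assms(1,2)
      m_closed[of a b] m_closed[of b a] by (simp_all add: a_def b_def)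
  have "Ra \<in> hecke_ideal S m q"
    using hecke_ideal_quadratic[OF \<open>s \<in> S\<close>] q by (simp add: Ra_def a_def scalar_def)
  moreover have "Rb \<in> hecke_ideal S m q"
    using hecke_ideal_quadratic[OF \<open>t \<in> S\<close>] by (simp add: Rb_def b_def)
  moreover have "R \<in> hecke_ideal S m q"
    using hecke_ideal_braid[of s t 3] assms
    by (simp add: R_def a_def b_def mult.assoc numeral_3_eq_3 numeral_eq_enat)
  \<comment> \<open>Modulo the ideal, \<open>b a b b = a b a b = a a b a = a b a = b a b\<close>.
    The first bracket records this chain in terms of the relators, the second its mirror
    image.\<close>
  ultimately have mem: "b * a * Rb - (R - R * b + Ra * b * a - a * R) \<in> hecke_ideal S m q"
      "Rb * (a * b) - (R - b * R + a * b * Ra - R * a) \<in> hecke_ideal S m q"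
    using C by (simp_all add: hecke_ideal_diff hecke_ideal_add hecke_ideal_mult_left hecke_ideal_mult_right)
  have "b * a * Rb - (R - R * b + Ra * b * a - a * R) = ?c * (b * a * b - b * a)"
    by (simp add: R_def Ra_def Rb_def algebra_simps scalar_mult_commute[of "q t", symmetric] scalar_mult_left_commute)
  moreover have "Rb * (a * b) - (R - b * R + a * b * Ra - R * a) = ?c * (b * a * b - a * b)"
    by (simp add: R_def Ra_def Rb_def algebra_simps scalar_mult_commute[of "q t", symmetric] scalar_mult_left_commute)
  ultimately have "?c * (b * a * b - b * a) - ?c * (b * a * b - a * b) \<in> hecke_ideal S m q"
    using hecke_ideal_diff[OF mem] by simp
  then have "?c * (a * b - b * a) \<in> hecke_ideal S m q"
    by (simp add: algebra_simps)
  then have "scalar (inverse (q t)) * (?c * (a * b - b * a)) \<in> hecke_ideal S m q"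
    by (rule hecke_ideal_mult_left) (rule scalar_in_free_algebra)
  then show ?thesis
    using q by (simp add: a_def b_def scalar_mult_scalar scalar_one flip: mult.assoc)
qed

end

section \<open>Representations of Hecke algebras\<close>

text \<open>\<open>foldr\<close> applies the last letter first, so that products act as
  compositions.\<close>

definition act :: "('f \<Rightarrow> 'v \<Rightarrow> 'v) \<Rightarrow> ('a \<Rightarrow> 'v \<Rightarrow> 'v) \<Rightarrow> ('a free_monoid \<Rightarrow>\<^sub>0 'f::field) \<Rightarrow> 'v \<Rightarrow> 'v::ab_group_add"
  where "act scale T p v =
    (\<Sum>w\<in>Poly_Mapping.keys p. scale (Poly_Mapping.lookup p w) (foldr T (letters w) v))"

locale free_algebra_action = vector_space scale
  for scale :: "'f::field \<Rightarrow> 'v \<Rightarrow> 'v::ab_group_add" (infixr \<open>*s\<close> 75) +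
  fixes T :: "'a \<Rightarrow> 'v \<Rightarrow> 'v"
  assumes T_add: "T s (u + v) = T s u + T s v"
    and T_scale: "T s (c *s v) = c *s T s v"
begin

lemma T_zero: "T s 0 = 0"
  using T_scale[of s 0 0] by simp

lemma foldr_T_add: "foldr T w (u + v) = foldr T w u + foldr T w v"
  by (induction w) (simp_all add: T_add)

lemma foldr_T_scale: "foldr T w (c *s v) = c *s foldr T w v"
  by (induction w) (simp_all add: T_scale)

lemma foldr_T_zero: "foldr T w 0 = 0"
  by (induction w) (simp_all add: T_zero)

lemma foldr_T_eq_zero:
  assumes "s \<in> set w" "\<And>v. T s v = 0"
  shows "foldr T w v = 0"
  using assms(1) by (induction w) (auto simp: assms(2) T_zero)

lemma act_superset:
  assumes "finite A" "Poly_Mapping.keys p \<subseteq> A"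
  shows "act scale T p v = (\<Sum>w\<in>A. Poly_Mapping.lookup p w *s foldr T (letters w) v)"
  unfolding act_def using assms
  by (intro sum.mono_neutral_left) (auto simp: in_keys_iff)

lemma act_add: "act scale T (p + r) v = act scale T p v + act scale T r v"
proof -
  let ?A = "Poly_Mapping.keys p \<union> Poly_Mapping.keys r"
  show ?thesis
    using Poly_Mapping.keys_add[of p r]
    by (simp add: act_superset[of ?A] lookup_add scale_left_distrib sum.distrib)
qed

lemma act_single: "act scale T (Poly_Mapping.single w c) v = c *s foldr T (letters w) v"
  by (subst act_superset[of "{w}"]) simp_all

lemma act_zero: "act scale T 0 v = 0"
  by (simp add: act_def)

lemma act_uminus: "act scale T (- p) v = - act scale T p v"
  using act_add[of p "- p" v] by (simp add: act_zero eq_neg_iff_add_eq_0 add.commute)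

lemma act_diff: "act scale T (p - r) v = act scale T p v - act scale T r v"
  using act_add[of p "- r" v] by (simp add: act_uminus)

lemma act_vector_zero: "act scale T p 0 = 0"
  by (simp add: act_def foldr_T_zero)

lemma act_mult: "act scale T (p * r) v = act scale T p (act scale T r v)"
proof -
  have single: "act scale T (Poly_Mapping.single w c * r) v =
      act scale T (Poly_Mapping.single w c) (act scale T r v)" for w c
  proof -
    have "act scale T (Poly_Mapping.single w c * (\<Sum>x\<in>A. Poly_Mapping.single x (f x))) v =
        act scale T (Poly_Mapping.single w c) (act scale T (\<Sum>x\<in>A. Poly_Mapping.single x (f x)) v)"
      for A f
      by (induction A rule: infinite_finite_induct)
        (simp_all add: act_zero act_vector_zero distrib_left act_add mult_single act_single
          plus_free_monoid_def foldr_T_add foldr_T_scale scale_right_distrib)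
    then show ?thesis
      using poly_mapping_eq_sum_single[of r] by metis
  qed
  have "act scale T ((\<Sum>x\<in>A. Poly_Mapping.single x (f x)) * r) v =
      act scale T (\<Sum>x\<in>A. Poly_Mapping.single x (f x)) (act scale T r v)" for A f
    by (induction A rule: infinite_finite_induct)
      (simp_all add: act_zero distrib_right act_add single)
  then show ?thesis
    using poly_mapping_eq_sum_single[of p] by metis
qed

lemma act_scalar: "act scale T (scalar c) v = c *s v"
  by (simp add: scalar_def act_single zero_free_monoid_def)

lemma act_one: "act scale T 1 v = v"
  using act_scalar[of 1 v] by (simp add: scalar_one)

lemma act_gen: "act scale T (gen s) v = T s v"
  by (simp add: gen_def act_single)

lemma act_prod_gen: "act scale T (prod_list (map gen w)) v = foldr T w v"
  by (induction w) (simp_all add: act_one act_mult act_gen)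

lemma ideal_annihilator:
  "ideal {p \<in> carrier (free_algebra S). \<forall>v. act scale T p v = 0} (free_algebra S)"
    (is "ideal ?J ?A")
proof -
  interpret A: ring "free_algebra S :: ('f, 'a free_monoid \<Rightarrow>\<^sub>0 'f) module"
    by (rule ring_free_algebra)
  show ?thesis
  proof (rule idealI)
    show "ring ?A"
      by (rule ring_free_algebra)
    show "subgroup ?J (add_monoid ?A)"
    proof (rule A.add.subgroupI)
      have "0 \<in> ?J"
        by (simp add: act_zero carrier_free_algebra)
      then show "?J \<noteq> {}"
        by blast
    next
      fix p
      assume p: "p \<in> ?J"
      then have "\<ominus>\<^bsub>?A\<^esub> p = - p"
        using a_minus_free_algebra[of 0 S p] A.zero_closed by (simp add: a_minus_def carrier_free_algebra)
      then show "\<ominus>\<^bsub>?A\<^esub> p \<in> ?J"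
        using p by (simp add: act_uminus carrier_free_algebra)
    next
      fix p r
      assume "p \<in> ?J" "r \<in> ?J"
      then show "p \<oplus>\<^bsub>?A\<^esub> r \<in> ?J"
        using A.add.m_closed[of p r] by (simp add: act_add)
    qed auto
  next
    fix p r
    assume "p \<in> ?J" "r \<in> carrier ?A"
    then show "r \<otimes>\<^bsub>?A\<^esub> p \<in> ?J" "p \<otimes>\<^bsub>?A\<^esub> r \<in> ?J"
      using A.m_closed[of p r] A.m_closed[of r p] by (simp_all add: act_mult act_vector_zero)
  qed
qed

end

locale hecke_representation = free_algebra_action scale T
  for scale :: "'f::field \<Rightarrow> 'v \<Rightarrow> 'v::ab_group_add" (infixr \<open>*s\<close> 75)
    and T :: "'a \<Rightarrow> 'v \<Rightarrow> 'v" +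
  fixes S :: "'a set" and m :: "'a \<Rightarrow> 'a \<Rightarrow> enat" and q :: "'a \<Rightarrow> 'f"
  assumes quadratic: "s \<in> S \<Longrightarrow> T s (T s v) + q s *s T s v = T s v + q s *s v"
    and braid: "s \<in> S \<Longrightarrow> t \<in> S \<Longrightarrow> s \<noteq> t \<Longrightarrow> m s t = enat k \<Longrightarrow>
      foldr T (alternating s t k) v = foldr T (alternating t s k) v"
begin

lemma act_relator:
  assumes "p \<in> hecke_relators S m q"
  shows "act scale T p v = 0"
proof -
  consider s where "p = (gen s - 1) * (gen s + scalar (q s))" "s \<in> S"
    | s t k where "p = prod_list (map gen (alternating s t k)) - prod_list (map gen (alternating t s k))"
        "s \<in> S" "t \<in> S" "s \<noteq> t" "m s t = enat k"
    using assms unfolding hecke_relators_def by blast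
  then show ?thesis
  proof cases
    case 1
    then show ?thesis
      using quadratic[of s v]
      by (simp add: act_mult act_diff act_add act_gen act_one act_scalar T_add T_scale)
  next
    case 2
    then show ?thesis
      using braid[of s t k v] by (simp add: act_diff act_prod_gen)
  qed
qed

text \<open>The annihilator of the representation is an ideal containing the relators, hence
  contains the ideal they generate.\<close>

lemma act_eq_zero_if_mem:
  assumes "p \<in> hecke_ideal S m q"
  shows "act scale T p v = 0"
proof -
  have "hecke_ideal S m q \<subseteq> {p \<in> carrier (free_algebra S). \<forall>v. act scale T p v = 0}"
    unfolding hecke_ideal_def using hecke_relators_subset[of S m q]
    by (intro ring.genideal_minimal ring_free_algebra ideal_annihilator) (auto simp: act_relator)
  then show ?thesis
    using assms by blast
qed

lemma T_commute_if_cring: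
  assumes "cring (hecke_algebra S m q)" "s \<in> S" "t \<in> S"
  shows "T s (T t v) = T t (T s v)"
proof -
  have "gen s * gen t - gen t * gen s \<in> hecke_ideal S m q"
    using assms by (simp add: cring_hecke_algebra_iff gen_in_free_algebra)
  then show ?thesis
    using act_eq_zero_if_mem[of "gen s * gen t - gen t * gen s" v]
    by (simp add: act_diff act_mult act_gen)
qed

end

section \<open>Alternating products of two deformed reflections\<close>

text \<open>
  Coordinates \<open>(B, C)\<close> of \<open>T s (T t (T s \<dots> z)) = z + B A\<^sub>s + C A\<^sub>t\<close>, where \<open>T u z = z - z\<^sub>u A\<^sub>u\<close>, the
  vectors \<open>A\<^sub>s, A\<^sub>t\<close> have \<open>s\<close>-entries \<open>1 + p, a\<close> and \<open>t\<close>-entries \<open>b, 1 + q\<close>, and \<open>z\<close> has entries \<open>x, y\<close>.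
\<close>

fun alt_coeffs :: "'k \<Rightarrow> 'k \<Rightarrow> 'k \<Rightarrow> 'k \<Rightarrow> 'k \<Rightarrow> 'k \<Rightarrow> nat \<Rightarrow> 'k \<times> 'k::comm_ring_1" where
  "alt_coeffs p q a b x y 0 = (0, 0)"
| "alt_coeffs p q a b x y (Suc n) =
    (case alt_coeffs q p b a y x n of (B, A) \<Rightarrow> (- x - p * A - a * B, B))"

lemma foldr_alternating_eq_alt_coeffs:
  fixes A :: "'a option \<Rightarrow> 'a \<Rightarrow> 'k::comm_ring_1"
  assumes "T s = (\<lambda>z i. z i - A i s * z (Some s))" "T t = (\<lambda>z i. z i - A i t * z (Some t))"
    and "A (Some s) s = 1 + p" "A (Some t) t = 1 + q"
  shows "foldr T (alternating s t n) z =
    (case alt_coeffs p q (A (Some s) t) (A (Some t) s) (z (Some s)) (z (Some t)) n of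
      (B, C) \<Rightarrow> (\<lambda>i. z i + B * A i s + C * A i t))"
  using assms
proof (induction n arbitrary: s t p q)
  case (Suc n)
  show ?case
    using Suc.IH[OF Suc.prems(2,1,4,3)] Suc.prems
    by (simp add: case_prod_beta) (simp add: fun_eq_iff algebra_simps)
qed simp

text \<open>The difference of the \<open>A\<^sub>s\<close> coordinates of the two sides of the braid
  relation. Exchanging the parameters gives the \<open>A\<^sub>t\<close> coordinate, up to
  sign.\<close>

definition alt_diff :: "'k \<Rightarrow> 'k \<Rightarrow> 'k \<Rightarrow> 'k \<Rightarrow> 'k \<Rightarrow> 'k \<Rightarrow> nat \<Rightarrow> 'k::comm_ring_1" where
  "alt_diff p q a b x y n = fst (alt_coeffs p q a b x y n) - snd (alt_coeffs q p b a y x n)"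

text \<open>
  On the span of \<open>A\<^sub>s\<close> and \<open>A\<^sub>t\<close> the product \<open>T s T t\<close> has trace \<open>a b - p - q\<close> and determinant \<open>p q\<close>, so
  this is an instance of the Cayley-Hamilton theorem.
\<close>

lemma alt_diff_rec:
  "alt_diff p q a b x y (Suc (Suc (Suc (Suc n)))) =
    (a * b - p - q) * alt_diff p q a b x y (Suc (Suc n)) - p * q * alt_diff p q a b x y n"
  by (simp add: alt_diff_def case_prod_beta) (simp add: algebra_simps)

text \<open>Up to rescaling, a Chebyshev polynomial of the second kind for \<open>c = 0\<close> and
  of the fourth kind for \<open>r = c * c\<close>; these serve even and odd braid lengths.\<close>

fun cheb :: "'k \<Rightarrow> 'k \<Rightarrow> nat \<Rightarrow> 'k::comm_ring_1 poly" where
  "cheb r c 0 = 1"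
| "cheb r c (Suc 0) = [:c, 1:]"
| "cheb r c (Suc (Suc n)) = pCons 0 (cheb r c (Suc n)) - smult r (cheb r c n)"

text \<open>Being monic keeps the degree equal to \<open>n\<close> in every characteristic, which
  later guarantees a root for \<open>n > 0\<close>.\<close>

lemma coeff_cheb: "coeff (cheb r c n) n = 1 \<and> (\<forall>i>n. coeff (cheb r c n) i = 0)"
proof (induction r c n rule: cheb.induct)
  case (2 r c)
  show ?case
    by (auto simp: coeff_pCons split: nat.split)
next
  case (3 r c n)
  then show ?case
    by (auto simp: coeff_pCons split: nat.split)
qed auto

lemma degree_cheb: "degree (cheb r c n :: 'k::comm_ring_1 poly) = n"
  using coeff_cheb[of r c n] by (intro antisym degree_le le_degree) auto

lemma cheb_solves_recurrence:
  fixes d :: "nat \<Rightarrow> 'k::comm_ring_1"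
  assumes "\<And>n. d (Suc (Suc n)) = u * d (Suc n) - r * d n" "d 0 = e" "d (Suc 0) = (u + c) * e"
  shows "d n = poly (cheb r c n) u * e"
  by (induction n rule: induct_nat_012) (simp_all add: assms algebra_simps)

text \<open>The sequence starts at length 2, where the difference is \<open>a * y\<close>.\<close>

lemma alt_diff_even:
  "alt_diff p q a b x y (Suc (Suc (2 * n))) = poly (cheb (p * q) 0 n) (a * b - p - q) * (a * y)"
  by (rule cheb_solves_recurrence[where d = "\<lambda>n. alt_diff p q a b x y (Suc (Suc (2 * n)))"])
    (simp_all add: alt_diff_rec, simp_all add: alt_diff_def eval_nat_numeral algebra_simps)

text \<open>Lengths 1 and 3 give \<open>- x\<close> and \<open>(a * b - p) * (- x)\<close>. Equal
  parameters make both coordinates lead to the same polynomial, so that one root serves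
  both.\<close>

lemma alt_diff_odd:
  "alt_diff p p a b x y (Suc (2 * n)) = poly (cheb (p * p) p n) (a * b - p - p) * (- x)"
  by (rule cheb_solves_recurrence[where d = "\<lambda>n. alt_diff p p a b x y (Suc (2 * n))"])
    (simp_all add: alt_diff_rec, simp_all add: alt_diff_def eval_nat_numeral algebra_simps)

text \<open>Since the polynomial variable is \<open>a * b - p - q\<close>, the constant is a root
  plus \<open>p + q\<close>. The bound on \<open>n\<close> makes the degree positive.\<close>

lemma ex_alt_coeffs_swap:
  fixes p q :: "'k::alg_closed_field"
  assumes "n \<ge> 3" "odd n \<Longrightarrow> p = q"
  shows "\<exists>c. \<forall>a b x y. a * b = c \<longrightarrow> alt_coeffs p q a b x y n = prod.swap (alt_coeffs q p b a y x n)"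
proof -
  have "\<exists>c. \<forall>a b x y. a * b = c \<longrightarrow> alt_diff p q a b x y n = 0 \<and> alt_diff q p b a y x n = 0"
  proof (cases "even n")
    case True
    define k where "k = n div 2 - 1"
    have k: "n = Suc (Suc (2 * k))" "k > 0"
      using assms(1) True unfolding k_def by presburger+
    obtain d where d: "poly (cheb (p * q) 0 k) d = 0"
      using alg_closed_imp_poly_has_root[of "cheb (p * q) 0 k"] k by (auto simp: degree_cheb)
    have "alt_diff p q a b x y n = 0 \<and> alt_diff q p b a y x n = 0" if "a * b = d + p + q" for a b x y
    proof -
      have "a * b - p - q = d" "b * a - q - p = d"
        using that by (simp_all add: algebra_simps)
      then show ?thesis
        using d by (simp add: k alt_diff_even mult.commute[of q p])
    qed
    then show ?thesis
      by blast
  next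
    case False
    then obtain k where k: "n = Suc (2 * k)" "k > 0"
      using assms(1) by (elim oddE) auto
    obtain d where d: "poly (cheb (p * p) p k) d = 0"
      using alg_closed_imp_poly_has_root[of "cheb (p * p) p k"] k by (auto simp: degree_cheb)
    have "alt_diff p q a b x y n = 0 \<and> alt_diff q p b a y x n = 0" if "a * b = d + p + p" for a b x y
    proof -
      have "a * b - p - p = d" "b * a - p - p = d"
        using that by (simp_all add: algebra_simps)
      moreover have "p = q"
        using assms(2) False by simp
      ultimately show ?thesis
        using d by (simp add: k alt_diff_odd)
    qed
    then show ?thesis
      by blast
  qed
  then show ?thesis
    by (simp add: alt_diff_def prod_eq_iff) metis
qed

section \<open>Noncommuting representations\<close>

lemma set_alternating: "n \<ge> 2 \<Longrightarrow> set (alternating s t n) = {s, t}"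
proof (induction n arbitrary: s t rule: dec_induct)
  case base
  show ?case
    by (simp add: numeral_2_eq_2)
qed auto

text \<open>Next to an identity, a braid relation compares two powers of \<open>T t\<close>. The
  exponents agree for \<open>n = 2\<close> and are positive for all \<open>n \<ge> 2\<close>, which
  suffices for idempotents.\<close>

lemma foldr_alternating_eq_powers:
  assumes "\<And>v. T u v = v"
  shows "foldr T (alternating u t n) v = (T t ^^ (n div 2)) v"
    and "foldr T (alternating t u n) v = (T t ^^ (Suc n div 2)) v"
proof (induction n)
  case (Suc n)
  {
    case 1
    show ?case
      using Suc.IH(2) by (simp add: assms)
  next
    case 2
    show ?case
      using Suc.IH(1) by simp
  }
qed simp_all

lemma idempotent_funpow:
  assumes "\<And>v. f (f v) = f v" "n > 0"
  shows "(f ^^ n) v = f v"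
  using assms(2) by (induction n rule: nat_induct_non_zero) (simp_all add: assms(1))

locale coxeter_matrix_parameters =
  fixes S :: "'a set" and m :: "'a \<Rightarrow> 'a \<Rightarrow> enat" and q :: "'a \<Rightarrow> 'f::field"
  assumes finite_S: "finite S"
    and m_ge_2: "s \<in> S \<Longrightarrow> t \<in> S \<Longrightarrow> s \<noteq> t \<Longrightarrow> 2 \<le> m s t"
    and m_sym: "s \<in> S \<Longrightarrow> t \<in> S \<Longrightarrow> s \<noteq> t \<Longrightarrow> m s t = m t s"
begin

lemma m_eq_2_if_invertible:
  assumes "collapse_free S m q" "cring (hecke_algebra S m q)"
    and "s \<in> S" "t \<in> S" "s \<noteq> t" "q s \<noteq> 0" "q t \<noteq> 0"
  shows "m s t = 2"
proof -
  let ?q = "\<lambda>u. to_ac (q u)"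
  \<comment> \<open>\<open>f\<close> orders \<open>S\<close>, to decide which of the two entries
    belonging to a pair is set to 1.\<close>
  obtain f :: "'a \<Rightarrow> nat" where f: "inj_on f S"
    using finite_imp_inj_to_nat_seg[OF finite_S] by blast
  define P where "P u v c \<longleftrightarrow> (\<forall>n. m u v = enat n \<longrightarrow> (\<forall>a b x y. a * b = c \<longrightarrow>
      alt_coeffs (?q u) (?q v) a b x y n = prod.swap (alt_coeffs (?q v) (?q u) b a y x n)))" for u v c
  have "\<exists>c. P u v c" if uv: "u \<in> S" "v \<in> S" "u \<noteq> v" "q u \<noteq> 0" "q v \<noteq> 0" "m u v \<noteq> 2" for u v
  proof (cases "m u v")
    case (enat n)
    have "odd n \<Longrightarrow> q u = q v"
      using assms(1) uv enat unfolding collapse_free_def by blast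
    moreover have "n \<ge> 3"
      using m_ge_2[OF uv(1-3)] uv(6) enat by (simp add: numeral_eq_enat)
    ultimately show ?thesis
      using ex_alt_coeffs_swap[of n "?q u" "?q v"] enat by (auto simp: P_def)
  qed (simp add: P_def)
  then obtain c where c: "\<And>u v. u \<in> S \<Longrightarrow> v \<in> S \<Longrightarrow> u \<noteq> v \<Longrightarrow> q u \<noteq> 0 \<Longrightarrow> q v \<noteq> 0 \<Longrightarrow>
      m u v \<noteq> 2 \<Longrightarrow> P u v (c u v)"
    by metis
  \<comment> \<open>Only the product \<open>A (Some u) v * A (Some v) u\<close> is prescribed. Setting one factor to 1 keeps \<open>T u\<close> and
    \<open>T v\<close> from commuting even if \<open>c u v = 0\<close>; for the same reason the index \<open>None\<close> makes every column nonzero.\<close>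
  define A :: "'a option \<Rightarrow> 'a \<Rightarrow> 'f alg_closure" where "A i u = (case i of None \<Rightarrow> 1
    | Some v \<Rightarrow> if v = u then 1 + ?q u else if m v u = 2 then 0 else if f v < f u then 1 else c u v)" for i u
  define T where "T u = (if q u = 0 then (\<lambda>z. 0) else (\<lambda>z i. z i - A i u * z (Some u)))" for u
  have diag: "A (Some u) u = 1 + ?q u" for u
    by (simp add: A_def)
  have T: "q u \<noteq> 0 \<Longrightarrow> T u = (\<lambda>z i. z i - A i u * z (Some u))"
    "q u = 0 \<Longrightarrow> T u = (\<lambda>z. 0)" for u
    by (simp_all add: T_def)
  have braid: "foldr T (alternating u v n) z = foldr T (alternating v u n) z"
    if uv: "u \<in> S" "v \<in> S" "f u < f v" "q u \<noteq> 0" "q v \<noteq> 0" "m u v = enat n" for u v n z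
  proof -
    have "u \<noteq> v"
      using uv by auto
    have "alt_coeffs (?q u) (?q v) (A (Some u) v) (A (Some v) u) x y n =
        prod.swap (alt_coeffs (?q v) (?q u) (A (Some v) u) (A (Some u) v) y x n)" for x y
    proof (cases "m u v = 2")
      case True
      then have "n = 2"
        using uv by (simp add: numeral_eq_enat)
      then show ?thesis
        using True m_sym[OF uv(1,2) \<open>u \<noteq> v\<close>] \<open>u \<noteq> v\<close> by (simp add: A_def numeral_2_eq_2)
    next
      case False
      then have "A (Some u) v * A (Some v) u = c u v"
        using m_sym[OF uv(1,2) \<open>u \<noteq> v\<close>] \<open>u \<noteq> v\<close> uv by (simp add: A_def)
      then show ?thesis
        using c[of u v] False uv \<open>u \<noteq> v\<close> by (simp add: P_def)
    qed
    then show ?thesis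
      using foldr_alternating_eq_alt_coeffs[OF T(1)[OF uv(4)] T(1)[OF uv(5)] diag diag, of n z]
        foldr_alternating_eq_alt_coeffs[OF T(1)[OF uv(5)] T(1)[OF uv(4)] diag diag, of n z]
      by (simp add: case_prod_beta fun_eq_iff)
  qed
  \<comment> \<open>The vectors have entries in the algebraic closure, but the Hecke algebra is over
    \<open>'f\<close>, so scalars act through the embedding.\<close>
  define scale where "scale c z = (\<lambda>i. to_ac c * z i)" for c and z :: "'a option \<Rightarrow> 'f alg_closure"
  interpret free_algebra_action scale T
  proof
    fix u c z w
    show "T u (z + w) = T u z + T u w" "T u (scale c z) = scale c (T u z)"
      by (cases "q u = 0"; simp add: T scale_def fun_eq_iff algebra_simps)+
  qed (simp_all add: scale_def fun_eq_iff algebra_simps)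
  interpret hecke_representation scale T S m q
  proof
    fix u z
    show "T u (T u z) + scale (q u) (T u z) = T u z + scale (q u) z"
      by (cases "q u = 0") (simp_all add: T diag scale_def fun_eq_iff algebra_simps)
  next
    fix u v n z
    assume uv: "u \<in> S" "v \<in> S" "u \<noteq> v" "m u v = enat n"
    then have n: "n \<ge> 2"
      using m_ge_2[of u v] by (simp add: numeral_eq_enat)
    consider w where "w \<in> {u, v}" "q w = 0" | "q u \<noteq> 0" "q v \<noteq> 0" "f u < f v"
      | "q u \<noteq> 0" "q v \<noteq> 0" "f v < f u"
      using inj_onD[OF f, of u v] uv by (metis insertCI linorder_neqE_nat)
    then show "foldr T (alternating u v n) z = foldr T (alternating v u n) z"
    proof cases
      case 1
      then have "T w z = 0" for z
        by (simp add: T_def)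
      then show ?thesis
        using 1 n foldr_T_eq_zero[of w] by (simp add: set_alternating insert_commute)
    next
      case 2
      then show ?thesis
        using uv braid by blast
    next
      case 3
      then show ?thesis
        using uv braid[of v u n z] m_sym[of u v] by simp
    qed
  qed
  have *: "m u v = 2" if uv: "u \<in> S" "v \<in> S" "f u < f v" "q u \<noteq> 0" "q v \<noteq> 0" for u v
  proof (rule ccontr)
    assume "m u v \<noteq> 2"
    \<comment> \<open>\<open>T u\<close> fixes \<open>z\<close>, so applying \<open>T v\<close>
      leaves -1 at \<open>None\<close>. In the other order, \<open>A (Some u) v = 1\<close> makes
      \<open>T u\<close> cancel this -1.\<close>
    define z :: "'a option \<Rightarrow> 'f alg_closure" where "z i = (if i = Some v then 1 else 0)" for i
    have "A (Some u) v = 1" "A None u = 1" "A None v = 1" "u \<noteq> v"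
      using uv \<open>m u v \<noteq> 2\<close> by (auto simp: A_def)
    then have "T u (T v z) None = 0" "T v (T u z) None = - 1"
      using uv by (simp_all add: T_def z_def)
    then show False
      using T_commute_if_cring[OF assms(2) uv(1,2), of z] by simp
  qed
  show ?thesis
    using *[of s t] *[of t s] assms m_sym[of s t] inj_onD[OF f, of s t] by (metis linorder_neqE_nat)
qed

lemma m_eq_2_or_3_if_noninvertible:
  assumes "cring (hecke_algebra S m q)" and st: "s \<in> S" "t \<in> S" "s \<noteq> t" and "q s = 0"
    and inv: "\<And>u. u \<in> S \<Longrightarrow> u \<noteq> t \<Longrightarrow> q u \<noteq> 0 \<Longrightarrow> q t \<noteq> 0 \<Longrightarrow> m t u = 2"
  shows "m s t = 2 \<or> m s t = 3 \<and> q t \<noteq> 0"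
proof (rule ccontr)
  assume contr: "\<not> ?thesis"
  \<comment> \<open>\<open>T s T t T s = 0\<close>, and \<open>T t T s T t = 0\<close> if \<open>q t = 0\<close>, so that long braid words vanish.\<close>
  define T :: "'a \<Rightarrow> 'f \<times> 'f \<Rightarrow> 'f \<times> 'f" where "T u = (\<lambda>(x, y).
    if u = s then (x, 0) else if u = t then (y, q t * x + (1 - q t) * y)
    else if q u = 0 then 0 else (x, y))" for u
  define scale where "scale c = (\<lambda>(x, y). (c * x, c * y))" for c :: 'f
  interpret free_algebra_action scale T
    by unfold_locales (auto simp: scale_def T_def zero_prod_def algebra_simps)
  \<comment> \<open>\<open>T t\<close> is a companion matrix of its quadratic relation with top left
    entry 0, and \<open>T s\<close> projects onto the first coordinate.\<close>
  have sts: "T s (T t (T s v)) = 0" for v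
    using st by (auto simp: T_def zero_prod_def split: prod.split)
  have tst: "T t (T s (T t v)) = 0" if "q t = 0" for v
    using st that by (auto simp: T_def zero_prod_def split: prod.split)
  have braid_st: "foldr T (alternating s t n) v = foldr T (alternating t s n) v" if "m s t = enat n" for n v
  proof -
    \<comment> \<open>Length 4 is the first at which both alternating words contain
      \<open>s t s\<close>.\<close>
    have "n \<ge> 4 \<or> n = 3 \<and> q t = 0"
      using contr that m_ge_2[OF st] by (auto simp: numeral_eq_enat)
    then consider k where "n = 4 + k" | "n = 3" "q t = 0"
      using le_Suc_ex by blast
    then show ?thesis
    proof cases
      case 1
      then show ?thesis
        by (simp add: eval_nat_numeral sts T_zero)
    next
      case 2
      then show ?thesis
        by (simp add: sts tst numeral_3_eq_3)
    qed
  qed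
  have braid_id: "foldr T (alternating u w n) v = foldr T (alternating w u n) v"
    if uw: "u \<in> S" "w \<in> S" "u \<noteq> w" "m u w = enat n" and id: "\<And>v. T u v = v" and w: "w = s \<or> w = t \<and> u \<noteq> s \<and> q u \<noteq> 0"
    for u w n v
  proof -
    have n: "n \<ge> 2"
      using m_ge_2[of u w] that by (simp add: numeral_eq_enat)
    \<comment> \<open>\<open>T w\<close> is idempotent unless \<open>w = t\<close> and
      \<open>q t \<noteq> 0\<close>, and there \<open>inv\<close> forces length 2.\<close>
    consider "\<And>v. T w (T w v) = T w v" | "n = 2"
    proof (cases "w = t \<and> q t \<noteq> 0")
      case True
      then have "n = 2"
        using inv[of u] uw w st m_sym[of u t] by (simp add: numeral_eq_enat)
      then show ?thesis
        using that by blast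
    next
      case False
      then have "T w (T w v) = T w v" for v
        using w by (auto simp: T_def split: prod.split)
      then show ?thesis
        using that by blast
    qed
    then show ?thesis
    proof cases
      case 1
      then show ?thesis
        using n by (simp add: foldr_alternating_eq_powers[of T u, OF id] idempotent_funpow[OF 1])
    next
      case 2
      then show ?thesis
        by (simp add: foldr_alternating_eq_powers[of T u, OF id])
    qed
  qed
  interpret hecke_representation scale T S m q
  proof
    fix u v
    show "T u (T u v) + scale (q u) (T u v) = T u v + scale (q u) v"
      using assms by (auto simp: T_def scale_def zero_prod_def algebra_simps split: prod.split)
  next
    fix u w n v
    assume uw: "u \<in> S" "w \<in> S" "u \<noteq> w" "m u w = enat n"
    then have n: "n \<ge> 2"
      using m_ge_2[of u w] by (simp add: numeral_eq_enat)
    have wu: "m w u = enat n"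
      using uw m_sym by simp
    consider x where "x \<in> {u, w}" "x \<notin> {s, t}" "q x = 0"
      | "u \<notin> {s, t}" "q u \<noteq> 0" "w \<in> {s, t}"
      | "w \<notin> {s, t}" "q w \<noteq> 0" "u \<in> {s, t}"
      | "u \<notin> {s, t}" "q u \<noteq> 0" "w \<notin> {s, t}" "q w \<noteq> 0"
      | "u = s" "w = t" | "u = t" "w = s"
      using uw by blast
    then show "foldr T (alternating u w n) v = foldr T (alternating w u n) v"
    proof cases
      case 1
      then have "T x v = 0" for v
        by (auto simp: T_def split: prod.split)
      then show ?thesis
        using 1 n foldr_T_eq_zero[of x] by (simp add: set_alternating insert_commute)
    next
      case 2
      then have "T u v = v" for v
        by (auto simp: T_def split: prod.split)
      then show ?thesis
        using braid_id[of u w n v] uw 2 by auto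
    next
      case 3
      then have "T w v = v" for v
        by (auto simp: T_def split: prod.split)
      then show ?thesis
        using braid_id[of w u n v] uw wu 3 by auto
    next
      case 4
      then have "T u v = v" "T w v = v" for v
        by (auto simp: T_def split: prod.split)
      then show ?thesis
        using n by (simp add: foldr_alternating_eq_powers[of T u] idempotent_funpow)
    next
      case 5
      then show ?thesis
        using braid_st uw by simp
    next
      case 6
      then show ?thesis
        using braid_st[of n v] wu by simp
    qed
  qed
  show False
    \<comment> \<open>On \<open>(0, 1)\<close> the product \<open>T s T t\<close> gives
      \<open>(1, 0)\<close>, whereas \<open>T t T s\<close> gives 0.\<close>
    using T_commute_if_cring[OF assms(1) st(1,2), of "(0, 1)"] st by (simp add: T_def)
qed

lemma hecke_commutative_iff:
  "collapse_free S m q \<and> cring (hecke_algebra S m q) \<longleftrightarrow>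
    simply_laced S m \<and> (\<forall>s\<in>S. \<forall>t\<in>S. s \<noteq> t \<longrightarrow> m s t = 3 \<longrightarrow> (q s = 0) \<noteq> (q t = 0))"
proof (intro iffI conjI)
  assume *: "collapse_free S m q \<and> cring (hecke_algebra S m q)"
  have "m s t = 2 \<or> m s t = 3 \<and> (q s = 0) \<noteq> (q t = 0)" if st: "s \<in> S" "t \<in> S" "s \<noteq> t" for s t
  proof -
    have two: "m u v = 2" if "u \<in> S" "v \<in> S" "v \<noteq> u" "q v \<noteq> 0" "q u \<noteq> 0" for u v
      using m_eq_2_if_invertible * that by blast
    consider "q s \<noteq> 0" "q t \<noteq> 0" | "q s = 0" | "q t = 0"
      by blast
    then show ?thesis
    proof cases
      case 1
      then show ?thesis
        using two[of s t] st by simp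
    next
      case 2
      then show ?thesis
        using m_eq_2_or_3_if_noninvertible[of s t] * st two by blast
    next
      case 3
      then show ?thesis
        using m_eq_2_or_3_if_noninvertible[of t s] m_sym[of s t] * st two by metis
    qed
  qed
  then show "simply_laced S m" "\<forall>s\<in>S. \<forall>t\<in>S. s \<noteq> t \<longrightarrow> m s t = 3 \<longrightarrow> (q s = 0) \<noteq> (q t = 0)"
    unfolding simply_laced_def by (fastforce simp: numeral_eq_enat)+
next
  assume *: "simply_laced S m \<and> (\<forall>s\<in>S. \<forall>t\<in>S. s \<noteq> t \<longrightarrow> m s t = 3 \<longrightarrow> (q s = 0) \<noteq> (q t = 0))"
  then show "collapse_free S m q"
    unfolding simply_laced_def collapse_free_def by (fastforce simp: numeral_eq_enat)
  have "gen s * gen t - gen t * gen s \<in> hecke_ideal S m q" if st: "s \<in> S" "t \<in> S" for s t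
  proof -
    have "m s t = 2 \<or> m s t = 3" if "s \<noteq> t"
      using * st that by (simp add: simply_laced_def)
    then consider "s = t" | "s \<noteq> t" "m s t = 2" | "s \<noteq> t" "m s t = 3" "q s = 0" "q t \<noteq> 0"
      | "s \<noteq> t" "m s t = 3" "q s \<noteq> 0" "q t = 0"
      using * st by blast
    then show ?thesis
    proof cases
      case 1
      then show ?thesis
        \<comment> \<open>The commutator is 0, which is in the ideal as a relator minus
          itself.\<close>
        using hecke_ideal_diff[OF hecke_ideal_quadratic hecke_ideal_quadratic, of s S s q m] st by simp
    next
      case 2
      then show ?thesis
        using hecke_ideal_braid[of s S t m 2 q] st by (simp add: numeral_eq_enat numeral_2_eq_2)
    next
      case 3
      then show ?thesis
        using braid3_commute_mem_hecke_ideal[of s S t m q] st by simp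
    next
      case 4
      then have "m t s = 3"
        using m_sym[of s t] st by simp
      then show ?thesis
        using hecke_ideal_uminus[OF braid3_commute_mem_hecke_ideal[of t S s m q]] 4 st by simp
    qed
  qed
  then show "cring (hecke_algebra S m q)"
    by (rule cring_hecke_algebra_if_gens_commute)
qed

end

theorem theorem1p4:
  fixes W :: "('a, 'b) monoid_scheme"
    and S :: "'a set"
    and m :: "'a \<Rightarrow> 'a \<Rightarrow> enat"
    and q :: "'a \<Rightarrow> 'f::field"
  assumes "coxeter_system W S m"
  shows "collapse_free S m q \<and> cring (hecke_algebra S m q) \<longleftrightarrow>
    simply_laced S m \<and>
    (\<forall>s\<in>S. \<forall>t\<in>S. s \<noteq> t \<longrightarrow> m s t = 3 \<longrightarrow> (q s = 0) \<noteq> (q t = 0))"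
proof -
  interpret coxeter_matrix_parameters S m q
    using assms by unfold_locales (auto simp: coxeter_system_def)
  show ?thesis
    by (rule hecke_commutative_iff)
qed

end
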